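(* There exist infinitely many bounded convex domains $\Omega$ in $\mathbf{R}^{1,n}$ such that $\delta_\Omega$ and $H_\Omega$ are not quasi-isometrically equivalent.
   Context: Minkowski space: $\mathbf{R}^{1,n}$ ($n\ge 1$) is $\mathbf{R}\times\mathbf{R}^n$ with coordinates $(t,p)$ and flat metric $\mathbf{b}=-dt^2+dp_1^2+\dots+dp_n^2$. A nonzero vector $v$ is lightlike if $\mathbf{b}(v,v)=0$. $|\cdot|$ and $d_h$ are the Euclidean norm and distance on $\mathbf{R}^{n+1}$. A domain is a nonempty, connected, proper open subset of $\mathbf{R}^{1,n}$. Markowitz pseudodistance: let $I=(-1,1)$ and $\rho_I(s,t)=\left|\ln\frac{(s-1)(t+1)}{(s+1)(t-1)}\right|$. For a domain $\Omega$, a projectively parametrized lightlike geodesic of $\Omega$ is a curve $\gamma:I\to\Omega$, $\gamma(s)=x+h(s)v$, with $v$ lightlike and $h$ a (nonconstant) real homography without pole in $I$. Then $\delta_\Omega(x,y)=\inf\sum_{k=1}^m\rho_I(s_k,t_k)$, the infimum being over all finite families of such geodesics $\gamma_1,\dots,\gamma_m$ and points $s_k,t_k\in I$ with $\gamma_1(s_1)=x$, $\gamma_m(t_m)=y$, $\gamma_k(t_k)=\gamma_{k+1}(s_{k+1})$. Hilbert metric: for a convex domain $\Omega$ containing no complete affine line, $H_\Omega$ is the distance obtained by integrating along piecewise smooth curves the Finsler metric $G_\Omega(v)=\frac{|v|}{d_h(x,x_v^-)}+\frac{|v|}{d_h(x,x_v^+)}$, $v\in T_x\Omega$, where $x_v^\pm$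 are the endpoints of the maximal affine segment of $\Omega$ through $x$ directed by $v$ (a term is $0$ if the corresponding endpoint is at infinity). Two distances $d_1,d_2$ on a set $X$ are quasi-isometrically equivalent if there are constants $\alpha,\beta>0$ with $\frac1\alpha d_1(x,y)-\beta\le d_2(x,y)\le\alpha d_1(x,y)+\beta$ for all $x,y\in X$. *)

theory Defs
  imports "HOL-Analysis.Analysis"
begin

text \<open>
  Minkowski space of dimension \<open>1 + n\<close> is the type \<open>real \<times> (real ^ 'n)\<close> with \<open>n = CARD('n) \<ge> 1\<close>;
  \<open>norm\<close> and \<open>dist\<close> of the product type are the Euclidean norm and distance on all coordinates.
\<close>

type_synonym 'n minkowski = "real \<times> (real ^ 'n)"

definition minkowski_form :: "'n::finite minkowski \<Rightarrow> 'n minkowski \<Rightarrow> real" where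
  "minkowski_form v w = - (fst v * fst w) + (\<Sum>i\<in>UNIV. snd v $ i * snd w $ i)"

definition lightlike :: "'n::finite minkowski \<Rightarrow> bool" where
  "lightlike v \<longleftrightarrow> v \<noteq> 0 \<and> minkowski_form v v = 0"

definition minkowski_domain :: "'n::finite minkowski set \<Rightarrow> bool" where
  "minkowski_domain \<Omega> \<longleftrightarrow> \<Omega> \<noteq> {} \<and> connected \<Omega> \<and> \<Omega> \<noteq> UNIV \<and> open \<Omega>"


subsection \<open>Markowitz pseudodistance\<close>

abbreviation unit_I :: "real set" where
  "unit_I \<equiv> {-1<..<1}"

definition rho_I :: "real \<Rightarrow> real \<Rightarrow> real" where
  "rho_I s t = \<bar>ln (((s - 1) * (t + 1)) / ((s + 1) * (t - 1)))\<bar>"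

definition homography_on_I :: "(real \<Rightarrow> real) \<Rightarrow> bool" where
  "homography_on_I h \<longleftrightarrow>
     (\<exists>a b c d. a * d - b * c \<noteq> 0 \<and>
        (\<forall>s\<in>unit_I. c * s + d \<noteq> 0 \<and> h s = (a * s + b) / (c * s + d)))"

definition proj_lightlike_geodesic ::
    "'n::finite minkowski set \<Rightarrow> (real \<Rightarrow> 'n minkowski) \<Rightarrow> bool" where
  "proj_lightlike_geodesic \<Omega> \<gamma> \<longleftrightarrow>
     \<gamma> ` unit_I \<subseteq> \<Omega> \<and>
     (\<exists>x v h. lightlike v \<and> homography_on_I h \<and> (\<forall>s\<in>unit_I. \<gamma> s = x + h s *\<^sub>R v))"

definition lightlike_chain ::
    "'n::finite minkowski set \<Rightarrow> 'n minkowski \<Rightarrow> 'n minkowski \<Rightarrow> nat \<Rightarrow>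
     (nat \<Rightarrow> real \<Rightarrow> 'n minkowski) \<Rightarrow> (nat \<Rightarrow> real) \<Rightarrow> (nat \<Rightarrow> real) \<Rightarrow> bool" where
  "lightlike_chain \<Omega> x y m \<gamma> s t \<longleftrightarrow>
     1 \<le> m \<and>
     (\<forall>k\<in>{1..m}. proj_lightlike_geodesic \<Omega> (\<gamma> k) \<and> s k \<in> unit_I \<and> t k \<in> unit_I) \<and>
     \<gamma> 1 (s 1) = x \<and> \<gamma> m (t m) = y \<and>
     (\<forall>k\<in>{1..<m}. \<gamma> k (t k) = \<gamma> (Suc k) (s (Suc k)))"

text \<open>
  The infimum is taken in the reals. It is over a set of nonnegative numbers, which is nonempty
  for \<open>x\<close> and \<open>y\<close> in a domain, since lightlike vectors span the space.
\<close>

definition markowitz_dist ::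
    "'n::finite minkowski set \<Rightarrow> 'n minkowski \<Rightarrow> 'n minkowski \<Rightarrow> real" where
  "markowitz_dist \<Omega> x y =
     Inf {(\<Sum>k=1..m. rho_I (s k) (t k)) | m \<gamma> s t. lightlike_chain \<Omega> x y m \<gamma> s t}"


subsection \<open>Hilbert metric\<close>

text \<open>
  For convex open \<open>\<Omega>\<close> containing \<open>x\<close>, the maximal segment through \<open>x\<close> directed by \<open>v\<close> leaves \<open>\<Omega>\<close>
  in the direction of \<open>v\<close> at parameter \<open>Sup (ray_times \<Omega> x v)\<close>. The endpoint is at infinity when
  this set is unbounded; this includes \<open>v = 0\<close>, so that \<open>hilbert_finsler \<Omega> x 0 = 0\<close>.
  The endpoint in the backward direction is the one directed by \<open>- v\<close>.
\<close>

definition ray_times :: "'a::real_vector set \<Rightarrow> 'a \<Rightarrow> 'a \<Rightarrow> real set" where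
  "ray_times \<Omega> x v = {r. 0 \<le> r \<and> x + r *\<^sub>R v \<in> \<Omega>}"

definition ray_endpoint :: "'a::real_vector set \<Rightarrow> 'a \<Rightarrow> 'a \<Rightarrow> 'a" where
  "ray_endpoint \<Omega> x v = x + Sup (ray_times \<Omega> x v) *\<^sub>R v"

definition hilbert_term :: "'a::real_normed_vector set \<Rightarrow> 'a \<Rightarrow> 'a \<Rightarrow> real" where
  "hilbert_term \<Omega> x v =
     (if bdd_above (ray_times \<Omega> x v) then norm v / dist x (ray_endpoint \<Omega> x v) else 0)"

definition hilbert_finsler :: "'a::real_normed_vector set \<Rightarrow> 'a \<Rightarrow> 'a \<Rightarrow> real" where
  "hilbert_finsler \<Omega> x v = hilbert_term \<Omega> x (- v) + hilbert_term \<Omega> x v"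

text \<open>
  Smoothness (all orders) on a closed interval, one-sided at the endpoints; \<open>D k\<close> is the
  \<open>k\<close>-th derivative.
\<close>

definition smooth_on_interval :: "(real \<Rightarrow> 'a::real_normed_vector) \<Rightarrow> real \<Rightarrow> real \<Rightarrow> bool" where
  "smooth_on_interval c a b \<longleftrightarrow>
     (\<exists>D :: nat \<Rightarrow> real \<Rightarrow> 'a. D 0 = c \<and>
        (\<forall>k. \<forall>u\<in>{a..b}. (D k has_vector_derivative D (Suc k) u) (at u within {a..b})))"

text \<open>
  The pieces are closed, so \<open>c\<close> is continuous and its derivative is bounded. The library's
  \<^const>\<open>piecewise_C1_differentiable_on\<close> allows the derivative to be unbounded near a break
  point; \<^const>\<open>integral\<close> would then assign length \<open>0\<close> to some curves of infinite length.
\<close>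

definition piecewise_smooth_path :: "(real \<Rightarrow> 'a::real_normed_vector) \<Rightarrow> bool" where
  "piecewise_smooth_path c \<longleftrightarrow>
     (\<exists>(m::nat) \<tau>. \<tau> 0 = 0 \<and> \<tau> m = 1 \<and>
        (\<forall>i<m. \<tau> i < \<tau> (Suc i) \<and> smooth_on_interval c (\<tau> i) (\<tau> (Suc i))))"

definition hilbert_length :: "'a::real_normed_vector set \<Rightarrow> (real \<Rightarrow> 'a) \<Rightarrow> real" where
  "hilbert_length \<Omega> c =
     integral {0..1} (\<lambda>u. hilbert_finsler \<Omega> (c u) (vector_derivative c (at u)))"

definition hilbert_dist :: "'a::real_normed_vector set \<Rightarrow> 'a \<Rightarrow> 'a \<Rightarrow> real" where
  "hilbert_dist \<Omega> x y =
     Inf {hilbert_length \<Omega> c | c. piecewise_smooth_path c \<and> path_image c \<subseteq> \<Omega> \<and>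
                                  pathstart c = x \<and> pathfinish c = y}"


subsection \<open>Quasi-isometric equivalence\<close>

definition quasi_isometrically_equivalent ::
    "'a set \<Rightarrow> ('a \<Rightarrow> 'a \<Rightarrow> real) \<Rightarrow> ('a \<Rightarrow> 'a \<Rightarrow> real) \<Rightarrow> bool" where
  "quasi_isometrically_equivalent X d1 d2 \<longleftrightarrow>
     (\<exists>\<alpha>>0. \<exists>\<beta>>0. \<forall>x\<in>X. \<forall>y\<in>X.
        1 / \<alpha> * d1 x y - \<beta> \<le> d2 x y \<and> d2 x y \<le> \<alpha> * d1 x y + \<beta>)"

end

theory Submission
  imports Defs
begin

text \<open>
  In the cylinder \<open>(0, a) \<times> B\<close> over the unit ball the face \<open>t = 0\<close> is spacelike, so a lightlike
  segment moves in space by exactly as much as it moves in \<open>t\<close>, while its \<open>\<rho>\<close>-length is at least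
  the variation of \<open>ln t\<close>. A chain of length \<open>S\<close> that starts at height \<open>\<epsilon>\<close> therefore stays below
  height \<open>\<epsilon> exp S\<close> and moves in space by at most \<open>S \<epsilon> exp S\<close>. Hence two points at height \<open>\<epsilon>\<close> with
  fixed spatial distance are arbitrarily far apart for the Markowitz distance as \<open>\<epsilon> \<rightarrow> 0\<close>,
  but the horizontal segment between them has bounded Hilbert length.
\<close>

section \<open>The distance \<open>rho_I\<close> and homographies of the interval\<close>

lemma rho_I_nonneg: "0 \<le> rho_I s t"
  by (simp add: rho_I_def)

text \<open>Otherwise the root \<open>- b / a\<close> would lie in \<open>unit_I\<close>. This turns
  the absence of poles or zeros into a condition on coefficients.\<close>

lemma affine_nonzero_on_I_imp_abs_le:
  fixes a b :: real
  assumes "\<And>s. s \<in> unit_I \<Longrightarrow> a * s + b \<noteq> 0"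
  shows "\<bar>a\<bar> \<le> \<bar>b\<bar>"
proof (rule ccontr)
  assume *: "\<not> \<bar>a\<bar> \<le> \<bar>b\<bar>"
  then have "a \<noteq> 0" by auto
  moreover have "\<bar>b / a\<bar> < 1"
    using * by (simp add: abs_divide)
  then have "- (b / a) \<in> unit_I"
    unfolding abs_less_iff greaterThanLessThan_iff by linarith
  ultimately show False
    using assms[of "- (b / a)"] by simp
qed

text \<open>An affine function that is nonnegative on I is a combination of \<open>1 + r\<close> and
  \<open>1 - r\<close> with nonnegative coefficients, and both bounds are linear in it, so they only
  have to hold for these two generators. Divided by \<open>1 - r\<close>, it becomes affine in the
  half-line coordinate \<open>(1 + r) / (1 - r)\<close>; \<open>E\<close> bounds the growth of that
  coordinate from \<open>s\<close> to \<open>t\<close>.\<close>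

lemma affine_ratio_bounds:
  fixes a b s t E :: real
  assumes "\<bar>a\<bar> \<le> b" and s: "s \<in> unit_I" and t: "t \<in> unit_I" and "1 \<le> E"
    and "(1 + t) * (1 - s) \<le> E * ((1 + s) * (1 - t))"
    and "(1 + s) * (1 - t) \<le> (1 + t) * (1 - s)"
  shows "(a * t + b) * (1 - s) \<le> E * ((a * s + b) * (1 - t))"
    and "(a * s + b) * (1 - t) \<le> (a * t + b) * (1 - s)"
proof -
  define p q where "p = (a + b) / 2" and "q = (b - a) / 2"
  have pq: "0 \<le> p" "0 \<le> q" using assms(1) by (auto simp: p_def q_def)
  have eq: "a * r + b = p * (1 + r) + q * (1 - r)" for r
    by (simp add: p_def q_def field_simps)
  have pos: "0 \<le> (1 - s) * (1 - t)" using s t by simp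
  have "p * ((1 + t) * (1 - s)) \<le> p * (E * ((1 + s) * (1 - t)))"
    using pq assms(5) by (intro mult_left_mono)
  moreover have "q * ((1 - s) * (1 - t)) \<le> E * (q * ((1 - s) * (1 - t)))"
    using mult_right_mono[OF \<open>1 \<le> E\<close>, of "q * ((1 - s) * (1 - t))"] pq pos by simp
  ultimately show "(a * t + b) * (1 - s) \<le> E * ((a * s + b) * (1 - t))"
    unfolding eq by (simp add: algebra_simps)
  have "p * ((1 + s) * (1 - t)) \<le> p * ((1 + t) * (1 - s))"
    using pq assms(6) by (intro mult_left_mono)
  then show "(a * s + b) * (1 - t) \<le> (a * t + b) * (1 - s)"
    unfolding eq by (simp add: algebra_simps)
qed

lemma rho_I_commute: "rho_I s t = rho_I t s"
proof -
  have "((t - 1) * (s + 1)) / ((t + 1) * (s - 1))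
      = inverse (((s - 1) * (t + 1)) / ((s + 1) * (t - 1)))"
    by (simp add: mult.commute)
  then show ?thesis
    unfolding rho_I_def by (simp only: ln_inverse abs_minus_cancel)
qed

text \<open>For \<open>s \<le> t\<close> the cross ratio is at least 1, so the absolute value in
  \<open>rho_I\<close> disappears.\<close>

lemma exp_rho_I:
  assumes "s \<in> unit_I" "t \<in> unit_I" "s \<le> t"
  shows "exp (rho_I s t) = ((1 + t) * (1 - s)) / ((1 + s) * (1 - t))"
proof -
  let ?r = "((1 + t) * (1 - s)) / ((1 + s) * (1 - t))"
  have eq: "((s - 1) * (t + 1)) / ((s + 1) * (t - 1)) = ?r"
  proof -
    have "(s - 1) * (t + 1) = - ((1 + t) * (1 - s))"
      "(s + 1) * (t - 1) = - ((1 + s) * (1 - t))"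
      by (simp_all add: algebra_simps)
    then show ?thesis by (simp only: minus_divide_divide)
  qed
  have "(1 + s) * (1 - t) > 0" using assms by simp
  moreover have "(1 + s) * (1 - t) \<le> (1 + t) * (1 - s)"
    using assms(3) by (simp add: algebra_simps)
  ultimately have "1 \<le> ?r" by (simp add: le_divide_eq)
  then show ?thesis unfolding rho_I_def eq by simp
qed

text \<open>After division by \<open>1 - r\<close>, the numerator grows by at most the factor
  \<open>exp (rho_I s t)\<close> from \<open>s\<close> to \<open>t\<close> and the denominator does
  not decrease. Multiplying the two bounds gives the claim.\<close>

lemma positive_homography_ratio_aux:
  fixes a b c d :: real
  assumes "s \<in> unit_I" "t \<in> unit_I" "s \<le> t"
    and num: "\<bar>a\<bar> \<le> b" "0 < a * s + b" "0 < a * t + b"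
    and den: "\<bar>c\<bar> \<le> d" "0 < c * s + d" "0 < c * t + d"
  shows "(a * t + b) / (c * t + d) \<le> exp (rho_I s t) * ((a * s + b) / (c * s + d))"
proof -
  let ?E = "exp (rho_I s t)"
  have pos: "(1 + s) * (1 - t) > 0" "0 < (1 - s) * (1 - t)" using assms by simp_all
  have E: "1 \<le> ?E" by (simp add: rho_I_nonneg)
  have cancel: "X / D * D = X" if "0 < D" for X D :: real using that by simp
  have le1: "(1 + t) * (1 - s) \<le> ?E * ((1 + s) * (1 - t))"
    unfolding exp_rho_I[OF assms(1-3)] cancel[OF pos(1)] by simp
  have le2: "(1 + s) * (1 - t) \<le> (1 + t) * (1 - s)"
    using assms(3) by (simp add: algebra_simps)
  have 1: "(a * t + b) * (1 - s) \<le> ?E * ((a * s + b) * (1 - t))"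
    by (rule affine_ratio_bounds(1)) (use assms E le1 le2 in auto)
  have 2: "(c * s + d) * (1 - t) \<le> (c * t + d) * (1 - s)"
    by (rule affine_ratio_bounds(2)) (use assms E le1 le2 in auto)
  have "((a * t + b) * (1 - s)) * ((c * s + d) * (1 - t))
      \<le> (?E * ((a * s + b) * (1 - t))) * ((c * t + d) * (1 - s))"
    by (rule mult_mono[OF 1 2]) (use assms in simp_all)
  then have "((a * t + b) * (c * s + d)) * ((1 - s) * (1 - t))
      \<le> (?E * ((a * s + b) * (c * t + d))) * ((1 - s) * (1 - t))"
    by (simp add: mult_ac)
  then have "(a * t + b) * (c * s + d) \<le> ?E * ((a * s + b) * (c * t + d))"
    using pos(2) by (simp only: mult_le_cancel_right_pos)
  then show ?thesis using den by (simp add: field_simps)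
qed

text \<open>
  The Schwarz lemma for homographies from \<open>(-1, 1)\<close> to the half-line: they contract \<open>\<rho>\<close> to the
  distance \<open>\<bar>ln p - ln q\<bar>\<close>.
\<close>

lemma positive_homography_ratio_le:
  assumes f: "\<And>r. r \<in> unit_I \<Longrightarrow> c * r + d \<noteq> 0 \<and> f r = (a * r + b) / (c * r + d) \<and> 0 < f r"
    and s: "s \<in> unit_I" and t: "t \<in> unit_I"
  shows "f t \<le> exp (rho_I s t) * f s"
proof -
  \<comment> \<open>Multiplying all coefficients by the sign of the denominator at 0 keeps
    \<open>f\<close> and makes the denominator, hence also the numerator, positive on I.\<close>
  define \<sigma> where "\<sigma> = sgn d"
  define a' b' c' d' where "a' = \<sigma> * a" and "b' = \<sigma> * b" and "c' = \<sigma> * c" and "d' = \<sigma> * d"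
  have "d \<noteq> 0" using f[of 0] by simp
  then have \<sigma>: "\<sigma> \<noteq> 0" "\<bar>\<sigma>\<bar> = 1" and "0 < d'"
    by (auto simp: \<sigma>_def d'_def sgn_if)
  have scale: "a' * r + b' = \<sigma> * (a * r + b)" "c' * r + d' = \<sigma> * (c * r + d)" for r
    by (simp_all add: a'_def b'_def c'_def d'_def algebra_simps)
  have f': "f r = (a' * r + b') / (c' * r + d')" if "r \<in> unit_I" for r
    using f[OF that] \<sigma> by (simp add: scale)
  have "\<bar>c'\<bar> \<le> \<bar>d'\<bar>"
    using f \<sigma> by (intro affine_nonzero_on_I_imp_abs_le) (simp only: scale mult_eq_0_iff, blast)
  then have cd: "\<bar>c'\<bar> \<le> d'" using \<open>0 < d'\<close> by simp
  have den: "0 < c' * r + d'" if "r \<in> unit_I" for r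
  proof -
    have "\<bar>c' * r\<bar> < d'"
    proof (cases "c' = 0")
      case False
      then have "\<bar>c'\<bar> * \<bar>r\<bar> < \<bar>c'\<bar> * 1" using that by (intro mult_strict_left_mono) auto
      then show ?thesis using cd by (simp add: abs_mult)
    qed (use \<open>0 < d'\<close> in simp)
    then show ?thesis by linarith
  qed
  have num: "0 < a' * r + b'" if "r \<in> unit_I" for r
    using f[OF that] f'[OF that] den[OF that] by (simp add: zero_less_divide_iff)
  have "\<bar>a'\<bar> \<le> \<bar>b'\<bar>"
    using num by (intro affine_nonzero_on_I_imp_abs_le) force
  moreover have "0 < b'" using num[of 0] by simp
  ultimately have ab: "\<bar>a'\<bar> \<le> b'" by simp
  show ?thesis
  proof (cases "s \<le> t")
    case True
    show ?thesis
      unfolding f'[OF s] f'[OF t]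
      by (rule positive_homography_ratio_aux) (use s t True ab cd num den in auto)
  next
    case False
    \<comment> \<open>The reflection of I at 0 reverses the order of \<open>s\<close> and
      \<open>t\<close> and preserves \<open>rho_I\<close>, which reduces this case to the previous
      one.\<close>
    have refl: "((- a') * (- r) + b') / ((- c') * (- r) + d') = f r" if "r \<in> unit_I" for r
      using f'[OF that] by simp
    have "((- a') * (- t) + b') / ((- c') * (- t) + d')
        \<le> exp (rho_I (- s) (- t)) * (((- a') * (- s) + b') / ((- c') * (- s) + d'))"
      by (rule positive_homography_ratio_aux) (use s t False ab cd num den in auto)
    moreover have "rho_I (- s) (- t) = rho_I s t"
    proof -
      have "rho_I (- s) (- t) = rho_I t s"
        unfolding rho_I_def
        by (rule arg_cong[where f = "\<lambda>z. \<bar>ln z\<bar>"]) (simp add: algebra_simps)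
      then show ?thesis by (simp add: rho_I_commute)
    qed
    ultimately show ?thesis by (simp only: refl[OF s] refl[OF t])
  qed
qed

section \<open>Lightlike geodesics and chains in the half-space \<open>t > 0\<close>\<close>

lemma lightlike_norm_snd:
  assumes "lightlike v"
  shows "norm (snd v) = \<bar>fst v\<bar>"
proof -
  have "(norm (snd v))\<^sup>2 = (fst v)\<^sup>2"
    using assms unfolding lightlike_def minkowski_form_def power2_norm_eq_inner inner_vec_def
    by (simp add: power2_eq_square)
  then show ?thesis by (metis abs_norm_cancel power2_eq_iff abs_minus_cancel)
qed

text \<open>Along the geodesic the time coordinate is an affine function of \<open>h\<close>, hence
  a quotient of affine functions with the denominator of \<open>h\<close>. It is positive, so the
  Schwarz lemma applies to it.\<close>

lemma proj_lightlike_geodesic_fst_le: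
  assumes "proj_lightlike_geodesic \<Omega> \<gamma>" "\<Omega> \<subseteq> {z. 0 < fst z}" "s \<in> unit_I" "t \<in> unit_I"
  shows "fst (\<gamma> t) \<le> exp (rho_I s t) * fst (\<gamma> s)"
proof -
  obtain x v h where \<gamma>: "\<And>r. r \<in> unit_I \<Longrightarrow> \<gamma> r = x + h r *\<^sub>R v" and "homography_on_I h"
    using assms(1) unfolding proj_lightlike_geodesic_def by blast
  then obtain a b c d where h: "\<And>r. r \<in> unit_I \<Longrightarrow> c * r + d \<noteq> 0 \<and> h r = (a * r + b) / (c * r + d)"
    unfolding homography_on_I_def by blast
  have "c * r + d \<noteq> 0 \<and>
      fst (\<gamma> r) = ((fst x * c + a * fst v) * r + (fst x * d + b * fst v)) / (c * r + d) \<and>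
      0 < fst (\<gamma> r)" if "r \<in> unit_I" for r
  proof (intro conjI)
    show nz: "c * r + d \<noteq> 0" using h[OF that] by simp
    have "fst x + (a * r + b) / (c * r + d) * fst v
        = (fst x * (c * r + d) + (a * r + b) * fst v) / (c * r + d)"
      using nz by (simp add: field_simps)
    then show "fst (\<gamma> r) = ((fst x * c + a * fst v) * r + (fst x * d + b * fst v)) / (c * r + d)"
      using h[OF that] by (simp add: \<gamma>[OF that] algebra_simps)
    show "0 < fst (\<gamma> r)"
      using assms(1,2) that unfolding proj_lightlike_geodesic_def by blast
  qed
  then show ?thesis
    by (rule positive_homography_ratio_le[where f = "\<lambda>r. fst (\<gamma> r)"]) (use assms in auto)
qed

lemma proj_lightlike_geodesic_norm_snd:
  assumes "proj_lightlike_geodesic \<Omega> \<gamma>" "s \<in> unit_I" "t \<in> unit_I"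
  shows "norm (snd (\<gamma> t) - snd (\<gamma> s)) = \<bar>fst (\<gamma> t) - fst (\<gamma> s)\<bar>"
proof -
  obtain x v h where \<gamma>: "\<And>r. r \<in> unit_I \<Longrightarrow> \<gamma> r = x + h r *\<^sub>R v" and v: "lightlike v"
    using assms(1) unfolding proj_lightlike_geodesic_def by blast
  have "snd (\<gamma> t) - snd (\<gamma> s) = (h t - h s) *\<^sub>R snd v"
    "fst (\<gamma> t) - fst (\<gamma> s) = (h t - h s) * fst v"
    using assms by (simp_all add: \<gamma> algebra_simps)
  then show ?thesis
    by (simp add: lightlike_norm_snd[OF v] abs_mult)
qed

text \<open>Turns a logarithmic bound below height \<open>M\<close> into a Euclidean one, by
  \<open>1 - exp (- r) \<le> r\<close>.\<close>

lemma abs_diff_le_of_exp_bounds: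
  fixes p q r M :: real
  assumes "q \<le> exp r * p" "p \<le> exp r * q" "p \<le> M" "q \<le> M" "0 \<le> r" "0 \<le> M"
  shows "\<bar>q - p\<bar> \<le> M * r"
proof -
  have *: "y - x \<le> M * r" if "y \<le> exp r * x" "y \<le> M" for x y :: real
  proof -
    have "exp (- r) * y \<le> x"
      using mult_left_mono[OF that(1), of "exp (- r)"] by (simp add: mult.assoc[symmetric] exp_add[symmetric])
    then have "y - x \<le> y * (1 - exp (- r))" by (simp add: algebra_simps)
    also have "\<dots> \<le> M * (1 - exp (- r))"
      using that assms(5) by (intro mult_right_mono) auto
    also have "\<dots> \<le> M * r"
      using exp_ge_add_one_self[of "- r"] assms(6) by (intro mult_left_mono) auto
    finally show ?thesis .
  qed
  show ?thesis using *[of q p] *[of p q] assms by (simp add: abs_le_iff)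
qed

lemma lightlike_chain_norm_snd_le:
  assumes chain: "lightlike_chain \<Omega> x y m \<gamma> s t" and pos: "\<Omega> \<subseteq> {z. 0 < fst z}"
  defines "S \<equiv> \<Sum>k=1..m. rho_I (s k) (t k)"
  shows "norm (snd y - snd x) \<le> S * fst x * exp S"
proof -
  \<comment> \<open>The vertices of the chain. Geodesics are numbered from 1, so index 0 is free for
    the starting point.\<close>
  define P where "P j = (if j = 0 then x else \<gamma> j (t j))" for j
  define T where "T j = (\<Sum>k=1..j. rho_I (s k) (t k))" for j
  have m: "1 \<le> m" using chain by (simp add: lightlike_chain_def)
  have geo: "proj_lightlike_geodesic \<Omega> (\<gamma> (Suc j))" "s (Suc j) \<in> unit_I" "t (Suc j) \<in> unit_I"
    if "j < m" for j
    using chain that by (auto simp: lightlike_chain_def)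
  have start: "\<gamma> (Suc j) (s (Suc j)) = P j" if "j < m" for j
    using chain that by (cases j) (auto simp: lightlike_chain_def P_def)
  have fst_x: "0 < fst x"
    using start[of 0] geo[of 0] m pos unfolding P_def proj_lightlike_geodesic_def by fastforce
  have T_nonneg: "0 \<le> T j" for j
    by (simp add: T_def sum_nonneg rho_I_nonneg)
  \<comment> \<open>Both bounds go into one induction, since the height reached so far controls how
    far the next piece can move in space.\<close>
  have "fst (P j) \<le> fst x * exp (T j) \<and> norm (snd (P j) - snd x) \<le> T j * fst x * exp (T j)"
    if "j \<le> m" for j
    using that
  proof (induction j)
    case 0
    show ?case by (simp add: P_def T_def)
  next
    case (Suc j)
    define r where "r = rho_I (s (Suc j)) (t (Suc j))"
    have j: "j < m" using Suc.prems by simp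
    have TS: "T (Suc j) = T j + r" by (simp add: T_def r_def)
    have r: "0 \<le> r" by (simp add: r_def rho_I_nonneg)
    have IH: "fst (P j) \<le> fst x * exp (T j)" "norm (snd (P j) - snd x) \<le> T j * fst x * exp (T j)"
      using Suc by simp_all
    let ?M = "fst x * exp (T (Suc j))"
    have PS: "P (Suc j) = \<gamma> (Suc j) (t (Suc j))" by (simp add: P_def)
    have up: "fst (P (Suc j)) \<le> exp r * fst (P j)"
      unfolding PS start[OF j, symmetric] r_def
      by (rule proj_lightlike_geodesic_fst_le[OF geo(1)[OF j] pos geo(2,3)[OF j]])
    \<comment> \<open>The same piece traversed backwards.\<close>
    have down: "fst (P j) \<le> exp r * fst (P (Suc j))"
      unfolding PS start[OF j, symmetric] r_def rho_I_commute[of "s (Suc j)"]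
      by (rule proj_lightlike_geodesic_fst_le[OF geo(1)[OF j] pos geo(3,2)[OF j]])
    have mono: "fst x * exp (T j) \<le> ?M"
      using fst_x r by (simp add: TS)
    note up
    also have "exp r * fst (P j) \<le> exp r * (fst x * exp (T j))"
      using IH by simp
    also have "\<dots> = ?M" by (simp add: TS exp_add mult_ac)
    finally have M: "fst (P (Suc j)) \<le> ?M" .
    have "norm (snd (P (Suc j)) - snd (P j)) = \<bar>fst (P (Suc j)) - fst (P j)\<bar>"
      unfolding PS start[OF j, symmetric]
      by (rule proj_lightlike_geodesic_norm_snd[OF geo(1)[OF j] geo(2,3)[OF j]])
    also have "\<dots> \<le> ?M * r"
      by (rule abs_diff_le_of_exp_bounds[OF up down]) (use order_trans[OF IH(1) mono] M r fst_x in auto)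
    finally have "norm (snd (P (Suc j)) - snd (P j)) \<le> ?M * r" .
    moreover have "T j * fst x * exp (T j) \<le> T j * ?M"
      using mult_left_mono[OF mono T_nonneg[of j]] by (simp add: mult.assoc)
    moreover have "norm (snd (P (Suc j)) - snd x)
        \<le> norm (snd (P (Suc j)) - snd (P j)) + norm (snd (P j) - snd x)"
      by (rule norm_diff_triangle_le) auto
    ultimately have "norm (snd (P (Suc j)) - snd x) \<le> ?M * r + T j * ?M"
      using IH by linarith
    also have "\<dots> = T (Suc j) * fst x * exp (T (Suc j))"
      by (simp add: TS algebra_simps)
    finally show ?case using M by simp
  qed
  from this[of m] show ?thesis
    using chain by (simp add: lightlike_chain_def P_def T_def S_def)
qed

section \<open>Existence of lightlike chains in convex open sets\<close>

lemma lightlike_segment_geodesic: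
  assumes "convex \<Omega>" "open \<Omega>" "P \<in> \<Omega>" "Q \<in> \<Omega>" "lightlike (Q - P)"
  obtains \<gamma> s t where "proj_lightlike_geodesic \<Omega> \<gamma>" "s \<in> unit_I" "t \<in> unit_I" "\<gamma> s = P" "\<gamma> t = Q"
proof -
  let ?v = "Q - P"
  \<comment> \<open>Since I is open, \<open>P\<close> and \<open>Q\<close> must be interior points
    of the geodesic; openness of \<open>\<Omega>\<close> lets the segment be prolonged by
    \<open>k\<close> times its length at both ends.\<close>
  have "((\<lambda>k. P - k *\<^sub>R ?v) \<longlongrightarrow> P - 0 *\<^sub>R ?v) (at_right 0)"
    "((\<lambda>k. Q + k *\<^sub>R ?v) \<longlongrightarrow> Q + 0 *\<^sub>R ?v) (at_right 0)"
    by (intro tendsto_intros)+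
  then have "\<forall>\<^sub>F k in at_right 0. P - k *\<^sub>R ?v \<in> \<Omega>" "\<forall>\<^sub>F k in at_right 0. Q + k *\<^sub>R ?v \<in> \<Omega>"
    using assms(2-4) by (auto dest: topological_tendstoD)
  then have "\<forall>\<^sub>F k in at_right (0::real). 0 < k \<and> P - k *\<^sub>R ?v \<in> \<Omega> \<and> Q + k *\<^sub>R ?v \<in> \<Omega>"
    by (intro eventually_conj eventually_at_right_less)
  then obtain k :: real where k: "0 < k" "P - k *\<^sub>R ?v \<in> \<Omega>" "Q + k *\<^sub>R ?v \<in> \<Omega>"
    using eventually_happens'[OF trivial_limit_at_right_real[of 0]] by blast
  \<comment> \<open>The affine map of I onto \<open>(-k, 1 + k)\<close>, written as a homography. It
    takes the values 0 and 1 at \<open>- 1 / (1 + 2 * k)\<close> and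
    \<open>1 / (1 + 2 * k)\<close>.\<close>
  define h where "h r = ((1/2 + k) * r + 1/2) / (0 * r + 1)" for r :: real
  define \<gamma> where "\<gamma> r = P + h r *\<^sub>R ?v" for r
  have "\<gamma> r \<in> \<Omega>" if "r \<in> unit_I" for r
  proof -
    define u where "u = (1 + r) / 2"
    have u: "0 \<le> 1 - u" "0 \<le> u" "(1 - u) + u = 1"
      using that by (simp_all add: u_def)
    have hu: "h r = u + u * k - (1 - u) * k" by (simp add: h_def u_def field_simps)
    \<comment> \<open>Stated for any \<open>w\<close>, so that \<open>Q - P\<close> is treated as a
      single vector.\<close>
    have "(1 - u) *\<^sub>R (P - k *\<^sub>R w) + u *\<^sub>R (P + w + l *\<^sub>R w)
        = P + (u + u * l - (1 - u) * k) *\<^sub>R w" for w l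
      by (simp add: algebra_simps)
    from this[of ?v k] have "(1 - u) *\<^sub>R (P - k *\<^sub>R ?v) + u *\<^sub>R (Q + k *\<^sub>R ?v) = \<gamma> r"
      unfolding \<gamma>_def hu by simp
    with convexD[OF assms(1) k(2,3) u] show ?thesis by simp
  qed
  moreover have "homography_on_I h"
    unfolding homography_on_I_def
    by (rule exI[of _ "1/2 + k"], rule exI[of _ "1/2"], rule exI[of _ 0], rule exI[of _ 1])
      (use k in \<open>simp add: h_def\<close>)
  ultimately have "proj_lightlike_geodesic \<Omega> \<gamma>"
    unfolding proj_lightlike_geodesic_def using assms(5) \<gamma>_def by blast
  moreover have "- 1 / (1 + 2 * k) \<in> unit_I" "1 / (1 + 2 * k) \<in> unit_I"
    using k by (simp_all add: field_simps)
  moreover have "h (- 1 / (1 + 2 * k)) = 0" "h (1 / (1 + 2 * k)) = 1"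
    using k by (simp_all add: h_def field_simps)
  then have "\<gamma> (- 1 / (1 + 2 * k)) = P" "\<gamma> (1 / (1 + 2 * k)) = Q"
    by (simp_all add: \<gamma>_def)
  ultimately show thesis by (rule that)
qed

text \<open>Provides a member of the set whose infimum is \<open>markowitz_dist\<close>; a lower
  bound for the members passes to \<open>Inf\<close> only if there is one.\<close>

lemma lightlike_chain_via:
  assumes "convex \<Omega>" "open \<Omega>" "P \<in> \<Omega>" "Q \<in> \<Omega>" "R \<in> \<Omega>" "lightlike (Q - P)" "lightlike (R - Q)"
  shows "\<exists>m \<gamma> s t. lightlike_chain \<Omega> P R m \<gamma> s t"
proof -
  obtain \<gamma>1 s1 t1 where 1: "proj_lightlike_geodesic \<Omega> \<gamma>1" "s1 \<in> unit_I" "t1 \<in> unit_I"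
      "\<gamma>1 s1 = P" "\<gamma>1 t1 = Q"
    using lightlike_segment_geodesic assms by metis
  obtain \<gamma>2 s2 t2 where 2: "proj_lightlike_geodesic \<Omega> \<gamma>2" "s2 \<in> unit_I" "t2 \<in> unit_I"
      "\<gamma>2 s2 = Q" "\<gamma>2 t2 = R"
    using lightlike_segment_geodesic assms by metis
  have "lightlike_chain \<Omega> P R 2 (\<lambda>k. if k = 1 then \<gamma>1 else \<gamma>2)
      (\<lambda>k. if k = 1 then s1 else s2) (\<lambda>k. if k = 1 then t1 else t2)"
    using 1 2 by (auto simp: lightlike_chain_def)
  then show ?thesis by blast
qed

section \<open>Upper bound for the Hilbert distance along a segment\<close>

lemma hilbert_term_nonneg: "0 \<le> hilbert_term \<Omega> x v"
  by (simp add: hilbert_term_def)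

text \<open>If the ray stays in \<open>\<Omega>\<close> up to Euclidean distance \<open>r\<close>,
  its endpoint is at least that far away. An endpoint at infinity or \<open>v = 0\<close> gives the
  term 0.\<close>

lemma hilbert_term_le:
  assumes "0 < r" and in_\<Omega>: "\<And>q. 0 \<le> q \<Longrightarrow> q * norm v < r \<Longrightarrow> x + q *\<^sub>R v \<in> \<Omega>"
  shows "hilbert_term \<Omega> x v \<le> norm v / r"
proof (cases "bdd_above (ray_times \<Omega> x v) \<and> v \<noteq> 0")
  case True
  let ?T = "Sup (ray_times \<Omega> x v)"
  have v: "0 < norm v" using True by simp
  have le: "q \<le> ?T" if "0 \<le> q" "q < r / norm v" for q
    using that True v by (intro cSup_upper) (auto simp: ray_times_def in_\<Omega> field_simps)
  \<comment> \<open>Only parameters strictly below \<open>r / norm v\<close> are known to stay in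
    \<open>\<Omega>\<close>, so the bound on the supremum is a limit.\<close>
  have "r / norm v \<le> ?T"
  proof (rule dense_le_bounded[of 0])
    show "0 < r / norm v" using assms v by simp
  qed (use le in auto)
  then have "r \<le> ?T * norm v" using v by (simp add: field_simps)
  moreover have "dist x (ray_endpoint \<Omega> x v) = \<bar>?T\<bar> * norm v"
    by (simp add: ray_endpoint_def dist_norm)
  moreover have "?T * norm v \<le> \<bar>?T\<bar> * norm v"
    by (intro mult_right_mono) auto
  ultimately have "r \<le> dist x (ray_endpoint \<Omega> x v)" by linarith
  then show ?thesis
    using True assms(1) by (simp add: hilbert_term_def frac_le)
qed (use assms in \<open>auto simp: hilbert_term_def\<close>)

text \<open>A non-integrable integrand gets the default value 0 of \<open>integral\<close>. The
  bound makes the infimum in \<open>hilbert_dist\<close> one over a set bounded below.\<close>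

lemma hilbert_length_nonneg: "0 \<le> hilbert_length \<Omega> c"
  unfolding hilbert_length_def hilbert_finsler_def
  by (cases "(\<lambda>u. hilbert_term \<Omega> (c u) (- vector_derivative c (at u)) +
        hilbert_term \<Omega> (c u) (vector_derivative c (at u))) integrable_on {0..1}")
    (auto intro!: integral_nonneg simp: hilbert_term_nonneg not_integrable_integral)

text \<open>The straight segment is a competitor. If its line stays in \<open>\<Omega>\<close> for a
  further distance \<open>r\<close> on both sides of each point, each of the two Finsler terms is at
  most \<open>norm (y - x) / r\<close>.\<close>

lemma hilbert_dist_segment_le:
  fixes x y :: "'a::real_normed_vector"
  assumes "0 < r"
    and in_\<Omega>: "\<And>u q. u \<in> {0..1} \<Longrightarrow> \<bar>q\<bar> * norm (y - x) < r \<Longrightarrow> x + (u + q) *\<^sub>R (y - x) \<in> \<Omega>"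
  shows "hilbert_dist \<Omega> x y \<le> 2 * norm (y - x) / r"
proof -
  define v where "v = y - x"
  define c where "c u = x + u *\<^sub>R v" for u
  have deriv: "(c has_vector_derivative v) (at u within X)" for u X
    unfolding c_def by (auto intro!: derivative_eq_intros)
  then have vd: "vector_derivative c (at u) = v" for u
    by (rule vector_derivative_at)
  have "smooth_on_interval c 0 1"
    unfolding smooth_on_interval_def
    by (rule exI[of _ "\<lambda>k. if k = 0 then c else if k = 1 then (\<lambda>_. v) else (\<lambda>_. 0)"])
      (use deriv in auto)
  \<comment> \<open>One piece suffices: \<open>real\<close> sends 0 and 1 to the break points 0 and
    1.\<close>
  then have pw: "piecewise_smooth_path c"
    unfolding piecewise_smooth_path_def
    by (intro exI[of _ 1] exI[of _ real]) auto
  have img: "path_image c \<subseteq> \<Omega>"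
    using in_\<Omega>[where q = 0] assms(1) by (auto simp: path_image_def c_def v_def)
  have "hilbert_length \<Omega> c \<le> 2 * norm v / r"
  proof -
    have le: "hilbert_finsler \<Omega> (c u) v \<le> 2 * norm v / r" if u: "u \<in> {0..1}" for u
    proof -
      have "hilbert_term \<Omega> (c u) (- v) \<le> norm (- v) / r"
      proof (rule hilbert_term_le[OF assms(1)])
        show "c u + q *\<^sub>R (- v) \<in> \<Omega>" if "0 \<le> q" "q * norm (- v) < r" for q
          using in_\<Omega>[OF u, of "- q"] that by (simp add: c_def v_def algebra_simps norm_minus_commute)
      qed
      moreover have "hilbert_term \<Omega> (c u) v \<le> norm v / r"
      proof (rule hilbert_term_le[OF assms(1)])
        show "c u + q *\<^sub>R v \<in> \<Omega>" if "0 \<le> q" "q * norm v < r" for q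
          using in_\<Omega>[OF u, of q] that by (simp add: c_def v_def algebra_simps)
      qed
      ultimately show ?thesis by (simp add: hilbert_finsler_def)
    qed
    show ?thesis
    proof (cases "(\<lambda>u. hilbert_finsler \<Omega> (c u) v) integrable_on {0..1}")
      case True
      then have "integral {0..1} (\<lambda>u. hilbert_finsler \<Omega> (c u) v)
          \<le> integral {0..1} (\<lambda>u::real. 2 * norm v / r)"
        by (rule integral_le) (use le in auto)
      then show ?thesis by (simp add: hilbert_length_def vd)
    next
      case False
      then show ?thesis using assms(1)
        by (simp add: hilbert_length_def vd not_integrable_integral)
    qed
  qed
  moreover have "hilbert_dist \<Omega> x y \<le> hilbert_length \<Omega> c"
    unfolding hilbert_dist_def
  proof (rule cInf_lower)
    show "bdd_below {hilbert_length \<Omega> c |c. piecewise_smooth_path c \<and> path_image c \<subseteq> \<Omega> \<and>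
        pathstart c = x \<and> pathfinish c = y}"
      by (intro bdd_belowI[of _ 0]) (auto simp: hilbert_length_nonneg)
  qed (use pw img in \<open>auto simp: pathstart_def pathfinish_def c_def v_def intro!: exI[of _ c]\<close>)
  ultimately show ?thesis by (simp add: v_def)
qed

section \<open>The cylinders and the comparison of the two distances\<close>

definition cylinder :: "real \<Rightarrow> 'n::finite minkowski set" where
  "cylinder a = {0<..<a} \<times> ball 0 1"

lemma mem_cylinder: "z \<in> cylinder a \<longleftrightarrow> 0 < fst z \<and> fst z < a \<and> norm (snd z) < 1"
  by (cases z) (auto simp: cylinder_def)

lemma convex_cylinder: "convex (cylinder a)"
  unfolding cylinder_def by (intro convex_Times convex_ball convex_real_interval)

lemma open_cylinder: "open (cylinder a)"
  unfolding cylinder_def by (intro open_Times) auto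

lemma bounded_cylinder: "bounded (cylinder a)"
  unfolding cylinder_def by (intro bounded_Times) auto

lemma minkowski_domain_cylinder:
  assumes "0 < a"
  shows "minkowski_domain (cylinder a :: 'n::finite minkowski set)"
proof -
  have "(a / 2, 0) \<in> (cylinder a :: 'n minkowski set)"
    using assms by (simp add: mem_cylinder)
  moreover have "(0, 0) \<notin> (cylinder a :: 'n minkowski set)" by (simp add: mem_cylinder)
  ultimately show ?thesis
    unfolding minkowski_domain_def
    using convex_connected[OF convex_cylinder] open_cylinder by blast
qed

text \<open>For given constants, one pair of points violates the upper bound on the Markowitz
  distance by the Hilbert distance. The assumption \<open>1 \<le> a\<close> leaves room for the
  auxiliary point \<open>z\<close> above the pair.\<close>

lemma cylinder_not_qi:
  fixes a :: real
  assumes "1 \<le> a"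
  shows "\<not> quasi_isometrically_equivalent (cylinder a :: 'n::finite minkowski set)
           (markowitz_dist (cylinder a)) (hilbert_dist (cylinder a))"
proof
  let ?\<Omega> = "cylinder a :: 'n minkowski set"
  assume "quasi_isometrically_equivalent ?\<Omega> (markowitz_dist ?\<Omega>) (hilbert_dist ?\<Omega>)"
  then obtain \<alpha> \<beta> where "0 < \<alpha>" "0 < \<beta>"
    and qi: "\<And>x y. x \<in> ?\<Omega> \<Longrightarrow> y \<in> ?\<Omega> \<Longrightarrow> 1 / \<alpha> * markowitz_dist ?\<Omega> x y - \<beta> \<le> hilbert_dist ?\<Omega> x y"
    unfolding quasi_isometrically_equivalent_def by blast
  \<comment> \<open>Once the Hilbert distance is at most 2, the equivalence allows a Markowitz
    distance of at most \<open>\<alpha> * (2 + \<beta>)\<close>; \<open>K\<close> exceeds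
    this.\<close>
  define K where "K = \<alpha> * (2 + \<beta>) + 1"
  have K: "1 \<le> K" using \<open>0 < \<alpha>\<close> \<open>0 < \<beta>\<close> by (simp add: K_def)
  \<comment> \<open>Chosen so that a chain shorter than \<open>K\<close> from height
    \<open>\<epsilon>\<close> moves in space by at most \<open>K * \<epsilon> * exp K = 1/4\<close>,
    less than the spatial distance 1/2 of \<open>x\<close> and \<open>y\<close>.\<close>
  define \<epsilon> where "\<epsilon> = 1 / (4 * (K * exp K))"
  have "1 * 1 \<le> K * exp K" using K by (intro mult_mono) auto
  then have \<epsilon>: "0 < \<epsilon>" "\<epsilon> \<le> 1/4" using K by (simp_all add: \<epsilon>_def field_simps)
  define e :: "real ^ 'n" where "e = axis undefined 1"
  have e: "norm e = 1" by (simp add: e_def)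
  have ee: "(\<Sum>i\<in>UNIV. e $ i * e $ i) = 1"
    using e by (simp add: norm_eq_1 inner_vec_def)
  \<comment> \<open>\<open>z\<close> lies over the midpoint of \<open>x\<close> and
    \<open>y\<close>, raised by half their distance, so that both \<open>z - x\<close> and
    \<open>y - z\<close> are lightlike.\<close>
  define x y z :: "'n minkowski"
    where "x = (\<epsilon>, 0)" and "y = (\<epsilon>, (1/2) *\<^sub>R e)" and "z = (\<epsilon> + 1/4, (1/4) *\<^sub>R e)"
  have mem: "x \<in> ?\<Omega>" "y \<in> ?\<Omega>" "z \<in> ?\<Omega>"
    using \<epsilon> assms by (simp_all add: mem_cylinder x_def y_def z_def e)

  have "z - x = (1/4, (1/4) *\<^sub>R e)" "y - z = (- 1/4, (1/4) *\<^sub>R e)"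
    by (simp_all add: x_def y_def z_def flip: scaleR_diff_left)
  moreover have "lightlike (b, (1/4) *\<^sub>R e)" if "b\<^sup>2 = (1/4)\<^sup>2" for b
  proof -
    have "b \<noteq> 0" using that by auto
    moreover have "(\<Sum>i\<in>UNIV. ((1/4) *\<^sub>R e) $ i * ((1/4) *\<^sub>R e) $ i)
        = (1/4)\<^sup>2 * (\<Sum>i\<in>UNIV. e $ i * e $ i)"
      unfolding sum_distrib_left by (rule sum.cong) (auto simp: power2_eq_square)
    ultimately show ?thesis
      using that unfolding lightlike_def minkowski_form_def ee fst_conv snd_conv
      by (simp add: power2_eq_square zero_prod_def)
  qed
  ultimately have "lightlike (z - x)" "lightlike (y - z)"
    by (simp_all add: power2_eq_square)
  then have ex: "\<exists>m \<gamma> s t. lightlike_chain ?\<Omega> x y m \<gamma> s t"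
    by (intro lightlike_chain_via[OF convex_cylinder open_cylinder mem(1,3,2)])
  have "K \<le> (\<Sum>k=1..m. rho_I (s k) (t k))" if chain: "lightlike_chain ?\<Omega> x y m \<gamma> s t" for m \<gamma> s t
  proof (rule ccontr)
    let ?S = "\<Sum>k=1..m. rho_I (s k) (t k)"
    assume "\<not> K \<le> ?S"
    moreover have "0 \<le> ?S" by (simp add: sum_nonneg rho_I_nonneg)
    ultimately have "?S * exp ?S \<le> K * exp K" by (intro mult_mono) auto
    then have "?S * exp ?S * \<epsilon> \<le> K * exp K * \<epsilon>" using \<epsilon> by (intro mult_right_mono) auto
    also have "\<dots> = 1/4" using K by (simp add: \<epsilon>_def)
    finally have "?S * \<epsilon> * exp ?S \<le> 1/4" by (simp add: mult_ac)
    moreover have "norm (snd y - snd x) \<le> ?S * fst x * exp ?S"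
      by (rule lightlike_chain_norm_snd_le[OF chain]) (auto simp: mem_cylinder)
    ultimately show False by (simp add: x_def y_def e)
  qed
  then have lower: "K \<le> markowitz_dist ?\<Omega> x y"
    unfolding markowitz_dist_def using ex by (intro cInf_greatest) auto

  have diff: "y - x = (0, (1/2) *\<^sub>R e)" by (simp add: x_def y_def)
  have norm: "norm (y - x) = 1/2" unfolding diff by (simp add: norm_Pair e)
  \<comment> \<open>The segment runs at constant height from the axis to radius 1/2, so it can be
    prolonged by 1/2 within the unit ball; the bound does not depend on
    \<open>\<epsilon>\<close>.\<close>
  have "hilbert_dist ?\<Omega> x y \<le> 2 * norm (y - x) / (1/2)"
  proof (rule hilbert_dist_segment_le)
    show "x + (u + q) *\<^sub>R (y - x) \<in> ?\<Omega>" if "u \<in> {0..1}" "\<bar>q\<bar> * norm (y - x) < 1/2" for u q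
      using that \<epsilon> assms unfolding norm unfolding diff by (auto simp: mem_cylinder x_def e)
  qed simp
  then have "hilbert_dist ?\<Omega> x y \<le> 2" by (simp add: norm)
  with qi[OF mem(1,2)] have "1 / \<alpha> * markowitz_dist ?\<Omega> x y \<le> 2 + \<beta>" by linarith
  then have "markowitz_dist ?\<Omega> x y \<le> \<alpha> * (2 + \<beta>)"
    using \<open>0 < \<alpha>\<close> by (simp add: field_simps)
  with lower show False by (simp add: K_def)
qed

lemma inj_on_cylinder: "inj_on (cylinder :: real \<Rightarrow> 'n::finite minkowski set) {0<..}"
proof (rule linorder_inj_onI')
  fix a b :: real
  assume "a \<in> {0<..}" "b \<in> {0<..}" "a < b"
  then have "(a, 0) \<in> (cylinder b :: 'n minkowski set)" "(a, 0) \<notin> (cylinder a :: 'n minkowski set)"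
    by (auto simp: mem_cylinder)
  then show "(cylinder a :: 'n minkowski set) \<noteq> cylinder b" by blast
qed

theorem corollary10p1:
  shows "infinite {\<Omega> :: (real \<times> (real ^ 'n::finite)) set.
           minkowski_domain \<Omega> \<and> convex \<Omega> \<and> bounded \<Omega> \<and>
           \<not> quasi_isometrically_equivalent \<Omega> (markowitz_dist \<Omega>) (hilbert_dist \<Omega>)}"
proof (rule infinite_super)
  \<comment> \<open>The heights \<open>a \<ge> 1\<close> already give infinitely many cylinders,
    told apart by their heights.\<close>
  show "(cylinder :: real \<Rightarrow> 'n minkowski set) ` {1..} \<subseteq> {\<Omega>.
      minkowski_domain \<Omega> \<and> convex \<Omega> \<and> bounded \<Omega> \<and>
      \<not> quasi_isometrically_equivalent \<Omega> (markowitz_dist \<Omega>) (hilbert_dist \<Omega>)}"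
    by (auto intro!: minkowski_domain_cylinder convex_cylinder bounded_cylinder simp: cylinder_not_qi)
  have "inj_on (cylinder :: real \<Rightarrow> 'n minkowski set) {1..}"
    by (rule inj_on_subset[OF inj_on_cylinder]) auto
  then show "infinite ((cylinder :: real \<Rightarrow> 'n minkowski set) ` {1..})"
    by (simp add: finite_image_iff infinite_Ici)
qed

end
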